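(* A compact metric space $X$ has the game theoretic property C if and only if it is countable dimensional.
   Context: A (metrizable) space $X$ is countable dimensional if it can be presented as a countable union of $0$-dimensional subsets (a separable metrizable space is $0$-dimensional if it has a base of clopen sets; the empty set is allowed). For a family $\mathcal U$ of subsets of a metric space, $\mathrm{mesh}\,\mathcal U=\sup\{\mathrm{diam}\,U\mid U\in\mathcal U\}$. A family is disjoint if its distinct members are pairwise disjoint. Game theoretic property C: a metric space $X$ has this property if player I has a winning strategy in the following game. On turn $i$ ($i=1,2,\dots$), player II chooses $\varepsilon_i>0$ and then player I chooses a disjoint family $\mathcal U_i$ of open subsets of $X$ with $\mathrm{mesh}\,\mathcal U_i<\varepsilon_i$. Player I wins if there is $k$ such that $\bigcup_{i=1}^k\mathcal U_i$ is a cover of $X$. *)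

theory Defs
  imports "HOL-Analysis.Analysis"
begin

(* As usual, 0-dimensionality via a base of clopen sets is the right notion for separable
   metrizable spaces; every subspace of a compact metric space is of this kind.  The empty
   space qualifies (with the empty base). *)
definition zero_dimensional_space :: "'a topology \<Rightarrow> bool" where
  "zero_dimensional_space T \<longleftrightarrow>
     (\<exists>\<B>. (\<forall>V\<in>\<B>. openin T V \<and> closedin T V) \<and>
          openin T = arbitrary union_of (\<lambda>V. V \<in> \<B>))"

definition countable_dimensional_space :: "'a topology \<Rightarrow> bool" where
  "countable_dimensional_space T \<longleftrightarrow>
     (\<exists>\<A>. countable \<A> \<and> \<Union>\<A> = topspace T \<and>
          (\<forall>A\<in>\<A>. zero_dimensional_space (subtopology T A)))"

(* The library's real-valued diameter is a meaningful supremum only for bounded sets. *)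
definition ediameter :: "'a::metric_space set \<Rightarrow> ennreal" where
  "ediameter S = (if bounded S then ennreal (diameter S) else \<infinity>)"

(* The supremum is taken in [0, infinity], so the empty family has mesh 0. *)
definition mesh :: "'a::metric_space set set \<Rightarrow> ennreal" where
  "mesh \<U> = (SUP U\<in>\<U>. ediameter U)"

definition legal_answer :: "'a::metric_space set \<Rightarrow> real \<Rightarrow> 'a set set \<Rightarrow> bool" where
  "legal_answer X \<epsilon> \<U> \<longleftrightarrow>
     disjoint \<U> \<and> (\<forall>U\<in>\<U>. openin (top_of_set X) U) \<and> mesh \<U> < ennreal \<epsilon>"

(* A strategy for player I maps the list of all previous turns (in chronological order, each
   consisting of the number chosen by II and the answer of I) and the number just chosen by II
   to the answer of I. *)
type_synonym 'a strategy = "(real \<times> 'a set set) list \<Rightarrow> real \<Rightarrow> 'a set set"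

(* Turns are numbered from 0. *)
definition play_according_to ::
    "'a strategy \<Rightarrow> (nat \<Rightarrow> real) \<Rightarrow> (nat \<Rightarrow> 'a set set) \<Rightarrow> bool" where
  "play_according_to \<sigma> \<epsilon> \<U> \<longleftrightarrow>
     (\<forall>i. \<U> i = \<sigma> (map (\<lambda>j. (\<epsilon> j, \<U> j)) [0..<i]) (\<epsilon> i))"

(* The game may be continued after I has covered X, since the empty family is always legal;
   hence only infinite plays are considered. *)
definition winning_strategy :: "'a::metric_space set \<Rightarrow> 'a strategy \<Rightarrow> bool" where
  "winning_strategy X \<sigma> \<longleftrightarrow>
     (\<forall>\<epsilon> \<U>. (\<forall>i. \<epsilon> i > 0) \<and> play_according_to \<sigma> \<epsilon> \<U> \<longrightarrow>
        (\<forall>i. legal_answer X (\<epsilon> i) (\<U> i)) \<and> (\<exists>k. X \<subseteq> \<Union>(\<Union>i\<le>k. \<U> i)))"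

definition game_property_C :: "'a::metric_space set \<Rightarrow> bool" where
  "game_property_C X \<longleftrightarrow> (\<exists>\<sigma>. winning_strategy X \<sigma>)"

end

(* If X is the union of zero-dimensional sets A_0, A_1, ..., then player I covers A_i on turn i:
   a countable cover of A_i by small relatively clopen sets can be made disjoint and then
   thickened to a disjoint family of open subsets of X.  All answers together cover X, hence
   finitely many turns suffice by compactness.

   Conversely, fix a winning strategy and let II play only numbers of the form 1/(n+1).  To each of
   the countably many finite sequences of such moves assign the set of points that I covers on the
   next turn whatever II plays there.  This set is zero-dimensional, since each possible next turn
   partitions it into relatively clopen sets, of arbitrarily small mesh.  A point in none
   of these sets would allow II to play so that it is never covered. *)
theory Submission
  imports Defs
begin

section \<open>Diameters and mesh\<close>

lemma diameter_leI:
  fixes S :: "'a::metric_space set"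
  assumes "0 \<le> d" "\<And>x y. x \<in> S \<Longrightarrow> y \<in> S \<Longrightarrow> dist x y \<le> d"
  shows "diameter S \<le> d"
  using assms by (auto simp: diameter_def intro!: cSUP_least)

lemma ediameter_subset_cball:
  assumes "S \<subseteq> cball p r" "0 \<le> r"
  shows "ediameter S \<le> ennreal (2 * r)"
proof -
  have "bounded S"
    using assms bounded_cball bounded_subset by blast
  moreover have "dist x y \<le> 2 * r" if "x \<in> S" "y \<in> S" for x y
  proof -
    have "dist p x \<le> r" "dist p y \<le> r"
      using assms(1) that by auto
    then show ?thesis
      using dist_triangle3[of x y p] by simp
  qed
  ultimately show ?thesis
    using assms by (auto simp: ediameter_def intro!: ennreal_leI diameter_leI)
qed

lemma dist_less_of_mesh_less:
  assumes "mesh \<U> < ennreal e" "U \<in> \<U>" "x \<in> U" "y \<in> U"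
  shows "dist x y < e"
proof -
  have "ediameter U < ennreal e"
    using assms(1,2) unfolding mesh_def by (meson SUP_upper le_less_trans)
  \<comment> \<open>An unbounded set has \<open>ediameter\<close> equal to infinity, so the strict
    bound forces boundedness.\<close>
  then have "bounded U" "diameter U < e"
    by (auto simp: ediameter_def ennreal_less_iff diameter_ge_0 split: if_splits)
  then show ?thesis
    using diameter_bounded_bound assms(3,4) by fastforce
qed

section \<open>Zero-dimensional and countable dimensional spaces\<close>

lemma zero_dimensional_space_iff_clopen_neighbourhoods:
  "zero_dimensional_space T \<longleftrightarrow>
     (\<forall>U x. openin T U \<and> x \<in> U \<longrightarrow> (\<exists>V. openin T V \<and> closedin T V \<and> x \<in> V \<and> V \<subseteq> U))"
proof
  assume "zero_dimensional_space T"
  then show "\<forall>U x. openin T U \<and> x \<in> U \<longrightarrow> (\<exists>V. openin T V \<and> closedin T V \<and> x \<in> V \<and> V \<subseteq> U)"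
    unfolding zero_dimensional_space_def openin_topology_base_unique by metis
next
  assume "\<forall>U x. openin T U \<and> x \<in> U \<longrightarrow> (\<exists>V. openin T V \<and> closedin T V \<and> x \<in> V \<and> V \<subseteq> U)"
  then show "zero_dimensional_space T"
    unfolding zero_dimensional_space_def openin_topology_base_unique
    by (intro exI[of _ "{V. openin T V \<and> closedin T V}"]) auto
qed

lemma countable_dimensional_space_top_of_set:
  "countable_dimensional_space (top_of_set X) \<longleftrightarrow>
     (\<exists>\<A>. countable \<A> \<and> \<Union>\<A> = X \<and> (\<forall>A\<in>\<A>. zero_dimensional_space (top_of_set A)))"
proof -
  have "subtopology (top_of_set X) A = top_of_set A" if "\<Union>\<A> = X" "A \<in> \<A>" for \<A> A
    using that by (auto simp: subtopology_subtopology Sup_upper intro!: arg_cong2[of _ _ _ _ subtopology])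
  then show ?thesis
    unfolding countable_dimensional_space_def by (intro ex_cong1) auto
qed

text \<open>Balls of radius 1/(n+1) around the points of a finite net, for every n, form a countable
  base. This makes every subspace of X Lindelof.\<close>

lemma compact_imp_second_countable:
  fixes X :: "'a::metric_space set"
  assumes "compact X"
  shows "second_countable (top_of_set X)"
proof -
  have "\<exists>D. finite D \<and> X \<subseteq> (\<Union>x\<in>D. ball x (inverse (Suc n)))" for n
    using compactE_image[OF assms, of X "\<lambda>x. ball x (inverse (Suc n))"]
    by (metis UN_I centre_in_ball inverse_positive_iff_positive of_nat_0_less_iff open_ball
        subsetI zero_less_Suc)
  then obtain D where D: "\<And>n. finite (D n)" "\<And>n. X \<subseteq> (\<Union>x\<in>D n. ball x (inverse (Suc n)))"
    by metis
  define \<B> where "\<B> = (\<Union>n. (\<lambda>d. X \<inter> ball d (inverse (Suc n))) ` D n)"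
  have "countable \<B>"
    unfolding \<B>_def using D(1) by (auto intro: countable_finite)
  moreover have "openin (top_of_set X) V" if "V \<in> \<B>" for V
    using that by (auto simp: \<B>_def)
  moreover have "\<exists>V\<in>\<B>. x \<in> V \<and> V \<subseteq> U" if U: "openin (top_of_set X) U" "x \<in> U" for U x
  proof -
    obtain r where r: "r > 0" "ball x r \<inter> X \<subseteq> U" and "x \<in> X"
      using U by (meson openin_contains_ball subsetD)
    \<comment> \<open>The points of a net ball containing x are within 2/(n+1) of x, hence the half
      of r.\<close>
    obtain n where n: "inverse (Suc n) < r / 2"
      using reals_Archimedean[of "r / 2"] r(1) by auto
    obtain d where d: "d \<in> D n" "x \<in> ball d (inverse (Suc n))"
      using D(2) \<open>x \<in> X\<close> by blast
    have "ball d (inverse (Suc n)) \<subseteq> ball x r"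
    proof
      fix y assume "y \<in> ball d (inverse (Suc n))"
      then show "y \<in> ball x r"
        using d(2) n dist_triangle[of x y d] by (simp add: dist_commute)
    qed
    then show ?thesis
      using d r(2) \<open>x \<in> X\<close> unfolding \<B>_def
      by (intro bexI[of _ "X \<inter> ball d (inverse (Suc n))"]) auto
  qed
  ultimately show ?thesis
    unfolding second_countable_def by blast
qed

section \<open>Covering a zero-dimensional subset in one turn\<close>

lemma zero_dimensional_subset_disjoint_open_cover:
  fixes X :: "'a::metric_space set"
  assumes "second_countable (top_of_set X)" "A \<subseteq> X" "zero_dimensional_space (top_of_set A)" "e > 0"
  obtains \<U> where "legal_answer X e \<U>" "A \<subseteq> \<Union>\<U>"
proof -
  \<comment> \<open>Radius e/4 bounds diameters by e/2, so the supremum over the whole family stays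
    strictly below e.\<close>
  define \<V> where "\<V> = {V. openin (top_of_set A) V \<and> closedin (top_of_set A) V \<and> (\<exists>p. V \<subseteq> ball p (e / 4))}"
  have "\<exists>V. openin (top_of_set A) V \<and> closedin (top_of_set A) V \<and> a \<in> V \<and> V \<subseteq> A \<inter> ball a (e / 4)"
    if "a \<in> A" for a
    using assms(3) that \<open>e > 0\<close> unfolding zero_dimensional_space_iff_clopen_neighbourhoods
    by (metis IntI centre_in_ball openin_open_Int open_ball zero_less_divide_iff zero_less_numeral)
  then have "a \<in> \<Union>\<V>" if "a \<in> A" for a
    using that unfolding \<V>_def Union_iff by (metis (mono_tags, lifting) le_inf_iff mem_Collect_eq)
  moreover have "\<Union>\<V> \<subseteq> A"
    unfolding \<V>_def by (auto dest: openin_imp_subset)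
  ultimately have "\<Union>\<V> = topspace (top_of_set A)"
    by auto
  moreover have "Lindelof_space (top_of_set A)"
    using second_countable_subtopology[OF assms(1), of A] assms(2)
    by (simp add: second_countable_imp_Lindelof_space subtopology_subtopology inf.absorb2)
  ultimately obtain \<W> where \<W>: "countable \<W>" "\<W> \<subseteq> \<V>" "\<Union>\<W> = A"
    using Lindelof_spaceD[of "top_of_set A" \<V>] by (auto simp: \<V>_def)
  \<comment> \<open>The empty set, itself in \<open>\<V>\<close>, makes the set to be enumerated
    nonempty, so that \<open>W\<close> has exactly this range.\<close>
  define W where "W = from_nat_into (insert {} \<W>)"
  have range_W: "range W = insert {} \<W>"
    unfolding W_def using \<W>(1) by (simp add: range_from_nat_into)
  have "{} \<in> \<V>"
    by (auto simp: \<V>_def)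
  then have W: "W n \<in> \<V>" for n
    using range_W \<W>(2) by (metis insertE rangeI subsetD)
  have "\<exists>p. W n \<subseteq> ball p (e / 4)" for n
    using W[of n] by (simp add: \<V>_def)
  then obtain p where p: "\<And>n. W n \<subseteq> ball (p n) (e / 4)"
    by metis
  define C where "C = disjointed W"
  \<comment> \<open>\<open>C n\<close> arises from the clopen \<open>W n\<close> by removing
    finitely many earlier clopen sets, whose union is closed.\<close>
  have C_open: "openin (top_of_set A) (C n)" for n
    using W unfolding C_def disjointed_def \<V>_def
    by (intro openin_diff closedin_Union) auto
  have C_cover: "(\<Union>n. C n) = A"
    using \<W>(3) by (simp add: C_def UN_disjointed_eq range_W)
  \<comment> \<open>Taking balls of half the radius allowed by the relatively open set keeps the
      thickenings of disjoint sets disjoint.\<close>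
  define T where "T n = X \<inter> ball (p n) (e / 4) \<inter>
      \<Union>{ball c r | c r. c \<in> C n \<and> ball c (2 * r) \<inter> A \<subseteq> C n}" for n
  have C_T: "C n \<subseteq> T n" for n
  proof
    fix c assume c: "c \<in> C n"
    then obtain r where "r > 0" "ball c r \<inter> A \<subseteq> C n"
      using C_open[of n] by (meson openin_contains_ball)
    then have "c \<in> ball c (r / 2)" "ball c (2 * (r / 2)) \<inter> A \<subseteq> C n"
      by auto
    moreover have "c \<in> X" "c \<in> ball (p n) (e / 4)"
      using c C_cover assms(2) p[of n] disjointed_subset[of W n] unfolding C_def by auto
    ultimately show "c \<in> T n"
      using c unfolding T_def by blast
  qed
  have T_disjoint: "T m \<inter> T n = {}" if "m \<noteq> n" for m n
  proof (rule ccontr)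
    assume "T m \<inter> T n \<noteq> {}"
    then obtain x c r c' r' where x: "x \<in> ball c r" "c \<in> C m" "ball c (2 * r) \<inter> A \<subseteq> C m"
      and x': "x \<in> ball c' r'" "c' \<in> C n" "ball c' (2 * r') \<inter> A \<subseteq> C n"
      unfolding T_def by blast
    have "dist c c' < r + r'"
      using x(1) x'(1) dist_triangle[of c c' x] by (simp add: dist_commute)
    \<comment> \<open>Otherwise \<open>dist c c'\<close> would be at least twice each radius, hence
      at least r + r'. The center inside the doubled ball of the other then lies in both
      \<open>C m\<close> and \<open>C n\<close>.\<close>
    then have "c' \<in> ball c (2 * r) \<or> c \<in> ball c' (2 * r')"
      by (auto simp: dist_commute)
    moreover have "c \<in> A" "c' \<in> A"
      using x(2) x'(2) C_cover by auto
    ultimately have "C m \<inter> C n \<noteq> {}"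
      using x x' by blast
    then show False
      using disjoint_family_disjointed[of W] that unfolding C_def by (auto simp: disjoint_family_on_def)
  qed
  have "mesh (range T) \<le> ennreal (2 * (e / 4))"
    unfolding mesh_def
  proof (rule SUP_least, elim rangeE)
    fix U n assume "U = T n"
    then have "U \<subseteq> cball (p n) (e / 4)"
      by (auto simp: T_def)
    then show "ediameter U \<le> ennreal (2 * (e / 4))"
      using \<open>e > 0\<close> by (intro ediameter_subset_cball) auto
  qed
  also have "\<dots> < ennreal e"
    using \<open>e > 0\<close> by (simp add: ennreal_less_iff)
  finally have "legal_answer X e (range T)"
    using T_disjoint
    by (auto simp: legal_answer_def disjoint_family_on_def T_def Int_assoc
        intro!: disjoint_family_on_disjoint_image openin_open_Int open_Int open_Union)
  moreover have "A \<subseteq> \<Union>(range T)"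
    using C_T C_cover by blast
  ultimately show thesis
    using that by blast
qed

section \<open>Positions of the game\<close>

text \<open>When I follows \<open>\<sigma>\<close>, the moves of II alone determine the position;
  this recovers the record of turns that \<open>\<sigma>\<close> takes as input.\<close>

definition history :: "'a strategy \<Rightarrow> real list \<Rightarrow> (real \<times> 'a set set) list" where
  "history \<sigma> = foldl (\<lambda>h e. h @ [(e, \<sigma> h e)]) []"

lemma history_Nil [simp]: "history \<sigma> [] = []"
  and history_snoc [simp]: "history \<sigma> (es @ [e]) = history \<sigma> es @ [(e, \<sigma> (history \<sigma> es) e)]"
  by (simp_all add: history_def)

text \<open>Turns an arbitrary sequence of moves of II into a play, to which the winning property
  can be applied.\<close>

lemma play_according_to_history:
  "play_according_to \<sigma> \<epsilon> (\<lambda>i. \<sigma> (history \<sigma> (map \<epsilon> [0..<i])) (\<epsilon> i))"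
proof -
  have hist: "history \<sigma> (map \<epsilon> [0..<i]) = map (\<lambda>j. (\<epsilon> j, \<sigma> (history \<sigma> (map \<epsilon> [0..<j])) (\<epsilon> j))) [0..<i]" for i
    by (induction i) auto
  show ?thesis
    unfolding play_according_to_def by (intro allI arg_cong2[where f = \<sigma>] hist refl)
qed

lemma winning_strategy_legal_answer:
  assumes "winning_strategy X \<sigma>" "\<forall>e'\<in>set es. e' > 0" "e > 0"
  shows "legal_answer X e (\<sigma> (history \<sigma> es) e)"
proof -
  \<comment> \<open>Winning speaks of infinite plays only, so the finite sequence of moves is
    continued by repeating e.\<close>
  define \<epsilon> where "\<epsilon> i = (if i < length es then es ! i else e)" for i
  have "\<epsilon> i > 0" for i
    using assms(2,3) by (auto simp: \<epsilon>_def)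
  then have "legal_answer X (\<epsilon> i) (\<sigma> (history \<sigma> (map \<epsilon> [0..<i])) (\<epsilon> i))" for i
    using assms(1) play_according_to_history[of \<sigma> \<epsilon>] unfolding winning_strategy_def by blast
  moreover have "map \<epsilon> [0..<length es] = es"
    by (rule nth_equalityI) (auto simp: \<epsilon>_def)
  ultimately have "legal_answer X (\<epsilon> (length es)) (\<sigma> (history \<sigma> es) (\<epsilon> (length es)))"
    by metis
  then show ?thesis
    by (simp add: \<epsilon>_def)
qed

section \<open>From a winning strategy to countable dimension\<close>

text \<open>Within A, the complement of the trace of one member is the union of the other traces, so
  all traces are clopen. As the mesh tends to 0, those containing a point shrink into any
  neighbourhood of it.\<close>

lemma zero_dimensional_space_if_small_disjoint_open_covers:
  fixes X A :: "'a::metric_space set"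
  assumes "A \<subseteq> X" "\<And>n. legal_answer X (inverse (Suc n)) (\<U> n)" "\<And>n. A \<subseteq> \<Union>(\<U> n)"
  shows "zero_dimensional_space (top_of_set A)"
  unfolding zero_dimensional_space_iff_clopen_neighbourhoods
proof (intro allI impI, elim conjE)
  fix V x assume V: "openin (top_of_set A) V" "x \<in> V"
  obtain r where r: "r > 0" "ball x r \<inter> A \<subseteq> V" and "x \<in> A"
    using V by (meson openin_contains_ball subsetD)
  obtain n where n: "inverse (Suc n) < r"
    using reals_Archimedean r(1) by auto
  obtain U where U: "U \<in> \<U> n" "x \<in> U"
    using assms(3) \<open>x \<in> A\<close> by blast
  have open_A: "openin (top_of_set A) (A \<inter> W)" if "openin (top_of_set X) W" for W
  proof -
    obtain O' where "open O'" "W = X \<inter> O'"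
      using \<open>openin (top_of_set X) W\<close> by (auto simp: openin_open)
    moreover from this have "A \<inter> W = A \<inter> O'"
      using assms(1) by blast
    ultimately show ?thesis
      by (simp add: openin_open_Int)
  qed
  have legal: "disjoint (\<U> n)" "\<And>W. W \<in> \<U> n \<Longrightarrow> openin (top_of_set X) W"
    "mesh (\<U> n) < ennreal (inverse (Suc n))"
    using assms(2)[of n] by (auto simp: legal_answer_def)
  have "A - A \<inter> U = A \<inter> \<Union>(\<U> n - {U})"
    using assms(3)[of n] legal(1) U(1) by (fastforce simp: disjoint_def)
  moreover have "openin (top_of_set A) (A \<inter> \<Union>(\<U> n - {U}))"
    using legal(2) by (intro open_A openin_Union) auto
  ultimately have "closedin (top_of_set A) (A \<inter> U)"
    by (simp add: closedin_def)
  moreover have "A \<inter> U \<subseteq> V"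
    using dist_less_of_mesh_less[OF legal(3) U(1) U(2)] n r(2) by fastforce
  ultimately show "\<exists>W. openin (top_of_set A) W \<and> closedin (top_of_set A) W \<and> x \<in> W \<and> W \<subseteq> V"
    using open_A legal(2) U \<open>x \<in> A\<close> by blast
qed

lemma game_property_C_imp_countable_dimensional:
  fixes X :: "'a::metric_space set"
  assumes "game_property_C X"
  shows "countable_dimensional_space (top_of_set X)"
proof -
  obtain \<sigma> where \<sigma>: "winning_strategy X \<sigma>"
    using assms by (auto simp: game_property_C_def)
  \<comment> \<open>Lists of natural numbers code the positions in question, so there are only
    countably many sets \<open>A ns\<close>.\<close>
  define moves where "moves = map (\<lambda>n. inverse (real (Suc n)))"
  define answer where "answer ns n = \<sigma> (history \<sigma> (moves ns)) (inverse (Suc n))" for ns and n :: nat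
  define A where "A ns = X \<inter> (\<Inter>n. \<Union>(answer ns n))" for ns
  have "legal_answer X (inverse (Suc n)) (answer ns n)" for ns n
    unfolding answer_def by (rule winning_strategy_legal_answer[OF \<sigma>]) (auto simp: moves_def)
  then have "zero_dimensional_space (top_of_set (A ns))" for ns
    by (rule zero_dimensional_space_if_small_disjoint_open_covers[rotated]) (auto simp: A_def)
  moreover have "X \<subseteq> \<Union>(range A)"
  proof (rule ccontr)
    assume "\<not> X \<subseteq> \<Union>(range A)"
    then obtain x where x: "x \<in> X" "\<And>ns. \<exists>n. x \<notin> \<Union>(answer ns n)"
      by (fastforce simp: A_def)
    \<comment> \<open>\<open>g\<close> is a counterstrategy of II that keeps x uncovered on the turn
      after each position.\<close>
    then obtain g where g: "\<And>ns. x \<notin> \<Union>(answer ns (g ns))"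
      by metis
    \<comment> \<open>\<open>L i\<close> codes the first i moves of II when playing by
      \<open>g\<close>.\<close>
    define L where "L = rec_nat [] (\<lambda>_ ns. ns @ [g ns])"
    define \<epsilon> where "\<epsilon> i = inverse (real (Suc (g (L i))))" for i
    have L: "map \<epsilon> [0..<i] = moves (L i)" for i
      by (induction i) (auto simp: L_def \<epsilon>_def moves_def)
    have "\<epsilon> i > 0" for i
      by (simp add: \<epsilon>_def)
    then obtain k where "X \<subseteq> \<Union>(\<Union>i\<le>k. \<sigma> (history \<sigma> (map \<epsilon> [0..<i])) (\<epsilon> i))"
      using \<sigma>[unfolded winning_strategy_def, rule_format, OF conjI, OF _ play_according_to_history[of \<sigma> \<epsilon>]]
      by blast
    then obtain i where "x \<in> \<Union>(\<sigma> (history \<sigma> (map \<epsilon> [0..<i])) (\<epsilon> i))"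
      using x(1) by blast
    then show False
      using g[of "L i"] unfolding L answer_def by (simp add: \<epsilon>_def)
  qed
  ultimately show ?thesis
    unfolding countable_dimensional_space_top_of_set
    by (intro exI[of _ "range A"]) (auto simp: A_def)
qed

section \<open>From countable dimension to a winning strategy\<close>

lemma countable_dimensional_imp_game_property_C:
  fixes X :: "'a::metric_space set"
  assumes "compact X" "countable_dimensional_space (top_of_set X)"
  shows "game_property_C X"
proof -
  obtain \<A> where \<A>: "countable \<A>" "\<Union>\<A> = X"
    and zero: "\<And>A. A \<in> \<A> \<Longrightarrow> zero_dimensional_space (top_of_set A)"
    using assms(2) unfolding countable_dimensional_space_top_of_set by blast
  have "zero_dimensional_space (top_of_set ({} :: 'a set))"
    by (auto simp: zero_dimensional_space_iff_clopen_neighbourhoods)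
  \<comment> \<open>Padding with the empty set allows for an empty \<open>\<A>\<close>.\<close>
  define A where "A = from_nat_into (insert {} \<A>)"
  have range_A: "range A = insert {} \<A>"
    unfolding A_def using \<A>(1) by (simp add: range_from_nat_into)
  have "A n \<subseteq> X" "zero_dimensional_space (top_of_set (A n))" for n
    using range_A \<A>(2) zero \<open>zero_dimensional_space (top_of_set {})\<close> by (metis Sup_upper empty_subsetI insertE rangeI)+
  then have "\<exists>\<U>. legal_answer X e \<U> \<and> A n \<subseteq> \<Union>\<U>" if "e > 0" for n e
    using zero_dimensional_subset_disjoint_open_cover compact_imp_second_countable assms(1) that by metis
  then have "\<forall>n e. \<exists>\<U>. e > 0 \<longrightarrow> legal_answer X e \<U> \<and> A n \<subseteq> \<Union>\<U>"
    by blast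
  then obtain F where F: "\<And>n e. e > 0 \<Longrightarrow> legal_answer X e (F n e) \<and> A n \<subseteq> \<Union>(F n e)"
    by metis
  \<comment> \<open>The length of the record is the number of the current turn, which selects the
    piece to be covered.\<close>
  have "winning_strategy X (\<lambda>h. F (length h))"
    unfolding winning_strategy_def
  proof (intro allI impI, elim conjE)
    fix \<epsilon> \<U> assume pos: "\<forall>i. \<epsilon> i > 0" and play: "play_according_to (\<lambda>h. F (length h)) \<epsilon> \<U>"
    have \<U>: "\<U> i = F i (\<epsilon> i)" for i
      using play[unfolded play_according_to_def, rule_format, of i] by simp
    have legal: "legal_answer X (\<epsilon> i) (\<U> i)" and cover: "A i \<subseteq> \<Union>(\<U> i)" for i
      using F pos by (auto simp: \<U>)
    have "\<Union>(range A) \<subseteq> \<Union>(\<Union>i. \<U> i)"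
      using cover by fastforce
    then have "X \<subseteq> \<Union>(\<Union>i. \<U> i)"
      using \<A>(2) by (simp add: range_A)
    moreover have "\<forall>U\<in>(\<Union>i. \<U> i). openin (top_of_set X) U"
      using legal by (auto simp: legal_answer_def)
    ultimately obtain \<F> where \<F>: "finite \<F>" "\<F> \<subseteq> (\<Union>i. \<U> i)" "X \<subseteq> \<Union>\<F>"
      using assms(1) unfolding compact_eq_openin_cover by (metis (no_types, lifting))
    then obtain I where I: "finite I" "\<F> \<subseteq> (\<Union>i\<in>I. \<U> i)"
      using finite_subset_Union[of \<F> "range \<U>"] finite_subset_image by (metis (no_types, lifting))
    \<comment> \<open>The finite subcover uses finitely many turns, so the last of them serves as k.
      If \<open>I\<close> is empty, \<open>Max I\<close> is unspecified but the inclusions are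
      trivial.\<close>
    then have "I \<subseteq> {..Max I}"
      by auto
    then have "\<F> \<subseteq> (\<Union>i\<le>Max I. \<U> i)"
      using I(2) by (meson UN_mono order.refl order.trans)
    then have "X \<subseteq> \<Union>(\<Union>i\<le>Max I. \<U> i)"
      using \<F>(3) by (meson Union_mono order.trans)
    then show "(\<forall>i. legal_answer X (\<epsilon> i) (\<U> i)) \<and> (\<exists>k. X \<subseteq> \<Union>(\<Union>i\<le>k. \<U> i))"
      using legal by blast
  qed
  then show ?thesis
    by (auto simp: game_property_C_def)
qed

theorem theorem5p3:
  fixes X :: "'a::metric_space set"
  assumes "compact X"
  shows "game_property_C X \<longleftrightarrow> countable_dimensional_space (top_of_set X)"
  using assms game_property_C_imp_countable_dimensional countable_dimensional_imp_game_property_C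
  by blast

end
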